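(* Let $G=(U,W,E)$ be a finite bipartite graph with $W\neq\emptyset$, let $d_u\in\mathbb{R}$ for $u\in U$, and let a map $f_v\colon\mathbb{R}^{\delta(v)}\to\mathbb{R}$ be given for every vertex $v\in U\cup W$. Let $$X^f=\{\boldsymbol{x}\in\mathbb{R}^E\colon f_u(\boldsymbol{x}_{\delta(u)})=d_u\ \ \forall u\in U\},$$ and let $\ell^{\max}(\boldsymbol{x})=\max_{w\in W}f_w(\boldsymbol{x}_{\delta(w)})$ and $\ell^{\min}(\boldsymbol{x})=\min_{w\in W}f_w(\boldsymbol{x}_{\delta(w)})$. Suppose that $f_v\in\mathcal{F}_{\delta(v)}$ for every vertex $v$ and that $G$ is connected. Then for every $\boldsymbol{x}\in X^f$ such that $\ell^{\max}(\boldsymbol{x})>\ell^{\min}(\boldsymbol{x})$, there exists $\boldsymbol{x}'\in X^f$ such that $$\ell^{\max}(\boldsymbol{x})>\ell^{\max}(\boldsymbol{x}')=\ell^{\min}(\boldsymbol{x}')>\ell^{\min}(\boldsymbol{x}).$$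
   Context: A bipartite graph $G=(U,W,E)$ has vertex set the disjoint union of $U$ and $W$, and every edge in $E$ joins a vertex of $U$ to a vertex of $W$. For a vertex $v$, $\delta(v)\subseteq E$ is the set of edges incident to $v$. For $\boldsymbol{x}\in\mathbb{R}^E$ and $A\subseteq E$, $\boldsymbol{x}_A=(x_e)_{e\in A}$. For a finite set $A$, $\mathcal{F}_A$ is the set of maps $f\colon\mathbb{R}^A\to\mathbb{R}$ such that, for every $i\in A$ and every fixed choice of the components $(x_k)_{k\in A\setminus\{i\}}$, the map $x_i\mapsto f(\boldsymbol{x}_A)$ is an increasing bijection from $\mathbb{R}$ onto $\mathbb{R}$. *)

theory Defs
  imports Complex_Main "HOL-Library.FuncSet"
begin

text \<open>Graphs are simple: an edge is identified with the set of its two end vertices.\<close>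

definition bipartite_graph :: "'v set \<Rightarrow> 'v set \<Rightarrow> 'v set set \<Rightarrow> bool" where
  "bipartite_graph U W E \<longleftrightarrow> U \<inter> W = {} \<and> (\<forall>e\<in>E. \<exists>u\<in>U. \<exists>w\<in>W. e = {u, w})"

definition graph_connected :: "'v set \<Rightarrow> 'v set set \<Rightarrow> bool" where
  "graph_connected V E \<longleftrightarrow> (\<forall>v\<in>V. \<forall>v'\<in>V. (v, v') \<in> {(a, b). {a, b} \<in> E}\<^sup>*)"

definition incident_edges :: "'v set set \<Rightarrow> 'v \<Rightarrow> 'v set set" where
  "incident_edges E v = {e \<in> E. v \<in> e}"

text \<open>
  The space of real vectors indexed by a set \<open>A\<close> is \<open>A \<rightarrow>\<^sub>E UNIV\<close>, and the subvector of \<open>x\<close>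
  indexed by \<open>A\<close> is \<open>restrict x A\<close>. Maps on this space are HOL functions whose values outside
  \<open>A \<rightarrow>\<^sub>E UNIV\<close> are unconstrained and never used.
\<close>

definition increasing_bij_maps :: "'e set \<Rightarrow> (('e \<Rightarrow> real) \<Rightarrow> real) set" where
  "increasing_bij_maps A =
    {f. \<forall>i\<in>A. \<forall>x \<in> A \<rightarrow>\<^sub>E UNIV.
          strict_mono (\<lambda>t. f (x(i := t))) \<and> bij (\<lambda>t. f (x(i := t)))}"

definition feasible_set ::
  "'v set \<Rightarrow> 'v set set \<Rightarrow> ('v \<Rightarrow> real) \<Rightarrow> ('v \<Rightarrow> ('v set \<Rightarrow> real) \<Rightarrow> real) \<Rightarrow> ('v set \<Rightarrow> real) set"
where
  "feasible_set U E d f =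
    {x \<in> E \<rightarrow>\<^sub>E UNIV. \<forall>u\<in>U. f u (restrict x (incident_edges E u)) = d u}"

definition load_max ::
  "'v set \<Rightarrow> 'v set set \<Rightarrow> ('v \<Rightarrow> ('v set \<Rightarrow> real) \<Rightarrow> real) \<Rightarrow> ('v set \<Rightarrow> real) \<Rightarrow> real"
where
  "load_max W E f x = Max ((\<lambda>w. f w (restrict x (incident_edges E w))) ` W)"

definition load_min ::
  "'v set \<Rightarrow> 'v set set \<Rightarrow> ('v \<Rightarrow> ('v set \<Rightarrow> real) \<Rightarrow> real) \<Rightarrow> ('v set \<Rightarrow> real) \<Rightarrow> real"
where
  "load_min W E f x = Min ((\<lambda>w. f w (restrict x (incident_edges E w))) ` W)"

end

theory Submission
  imports Defs
begin

text \<open>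
  Fix the coordinates of \<open>x\<close> outside a spanning tree and root the tree at some \<open>r \<in> W\<close>. For every
  \<open>s\<close>, solving for the tree edges from the leaves towards the root gives a vector that satisfies the
  constraints at \<open>U\<close> and has load \<open>s\<close> at every vertex of \<open>W\<close> other than \<open>r\<close>; its load at \<open>r\<close> depends
  continuously on \<open>s\<close>. A comparison principle says that two vectors that agree outside the tree are
  equal as soon as one has larger loads at \<open>W\<close> and smaller ones at \<open>U\<close>. Hence the load at \<open>r\<close> is
  less than \<open>s\<close> when \<open>s\<close> is the maximal load of \<open>x\<close> and greater than \<open>s\<close> when \<open>s\<close> is the minimal
  one, so that the intermediate value theorem gives a vector with all loads equal to some \<open>s\<close>
  strictly in between.
\<close>

section \<open>Continuity of maps that are increasing bijections in each coordinate\<close>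

lemma increasing_bij_maps_restrict_upd:
  assumes "f \<in> increasing_bij_maps A" and "e \<in> A"
  shows "strict_mono (\<lambda>t. f (restrict (x(e := t)) A))"
    and "bij (\<lambda>t. f (restrict (x(e := t)) A))"
proof -
  have "restrict (x(e := t)) A = (restrict x A)(e := t)" for t
    using assms(2) by (auto simp: restrict_def)
  moreover have "restrict x A \<in> A \<rightarrow>\<^sub>E UNIV"
    by simp
  ultimately show "strict_mono (\<lambda>t. f (restrict (x(e := t)) A))"
    and "bij (\<lambda>t. f (restrict (x(e := t)) A))"
    using assms unfolding increasing_bij_maps_def by auto
qed

text \<open>Coordinates are released one at a time. To stay above a level \<open>c\<close>, freeze
  coordinate \<open>e\<close> slightly below \<open>b e\<close>, at a \<open>t\<close> where the
  value is still above \<open>c\<close>; surjectivity in \<open>e\<close> supplies \<open>t\<close>.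
  The other coordinates then move by induction, and monotonicity in \<open>e\<close> carries the
  bound from \<open>t\<close> to \<open>B s e\<close>. Upper bounds are symmetric.\<close>

lemma tendsto_increasing_bij_maps_override_on:
  fixes f :: "('e \<Rightarrow> real) \<Rightarrow> real"
  assumes f: "f \<in> increasing_bij_maps A" and "finite C" and "C \<subseteq> A"
    and "\<And>e. e \<in> C \<Longrightarrow> ((\<lambda>s. B s e) \<longlongrightarrow> b e) F"
  shows "((\<lambda>s. f (restrict (override_on b (B s) C) A)) \<longlongrightarrow> f (restrict b A)) F"
  using assms(2-4)
proof (induction C arbitrary: b rule: finite_induct)
  case empty
  show ?case by simp
next
  case (insert e C)
  let ?g = "\<lambda>x. f (restrict x A)"
  have e: "e \<in> A" using insert.prems(1) by simp
  note mono = increasing_bij_maps_restrict_upd(1)[OF f e]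
  have surj: "\<exists>t. ?g (b(e := t)) = m" for m
    by (rule bij_pointE[OF increasing_bij_maps_restrict_upd(2)[OF f e, of b], of m]) auto
  have upd: "override_on b (B s) (insert e C) = (override_on (b(e := t)) (B s) C)(e := B s e)"
    and upd': "override_on (b(e := t)) (B s) C = (override_on (b(e := t)) (B s) C)(e := t)" for s t
    using insert.hyps by (auto simp: override_on_def)
  have IH: "((\<lambda>s. ?g (override_on (b(e := t)) (B s) C)) \<longlongrightarrow> ?g (b(e := t))) F" for t
    using insert by (intro insert.IH) auto
  have lim: "((\<lambda>s. B s e) \<longlongrightarrow> b e) F" using insert.prems(2) by simp
  show ?case
  proof (rule order_tendstoI)
    fix c assume "c < ?g b"
    then obtain m where m: "c < m" "m < ?g b" using dense by blast
    obtain t where t: "?g (b(e := t)) = m" using surj by blast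
    have "t < b e"
      using strict_mono_less[OF mono, of b t "b e"] t m by simp
    then have "\<forall>\<^sub>F s in F. t < B s e" using lim order_tendstoD(1) by blast
    moreover have "\<forall>\<^sub>F s in F. c < ?g (override_on (b(e := t)) (B s) C)"
      using order_tendstoD(1)[OF IH[of t]] t m by simp
    ultimately show "\<forall>\<^sub>F s in F. c < ?g (override_on b (B s) (insert e C))"
    proof eventually_elim
      case (elim s)
      then show ?case
        using strict_mono_less[OF mono, of "override_on (b(e := t)) (B s) C" t "B s e"]
        by (metis upd upd' less_trans)
    qed
  next
    fix c assume "?g b < c"
    then obtain m where m: "m < c" "?g b < m" using dense by blast
    obtain t where t: "?g (b(e := t)) = m" using surj by blast
    have "b e < t"
      using strict_mono_less[OF mono, of b "b e" t] t m by simp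
    then have "\<forall>\<^sub>F s in F. B s e < t" using lim order_tendstoD(2) by blast
    moreover have "\<forall>\<^sub>F s in F. ?g (override_on (b(e := t)) (B s) C) < c"
      using order_tendstoD(2)[OF IH[of t]] t m by simp
    ultimately show "\<forall>\<^sub>F s in F. ?g (override_on b (B s) (insert e C)) < c"
    proof eventually_elim
      case (elim s)
      then show ?case
        using strict_mono_less[OF mono, of "override_on (b(e := t)) (B s) C" "B s e" t]
        by (metis upd upd' less_trans)
    qed
  qed
qed

lemma tendsto_increasing_bij_maps:
  fixes f :: "('e \<Rightarrow> real) \<Rightarrow> real"
  assumes "f \<in> increasing_bij_maps A" and "finite A"
    and "\<And>e. e \<in> A \<Longrightarrow> ((\<lambda>s. B s e) \<longlongrightarrow> b e) F"
  shows "((\<lambda>s. f (restrict (B s) A)) \<longlongrightarrow> f (restrict b A)) F"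
proof -
  have "restrict (override_on b (B s) A) A = restrict (B s) A" for s
    by (auto simp: restrict_def override_on_def)
  with tendsto_increasing_bij_maps_override_on[OF assms(1,2) subset_refl, of B b F] assms(3)
  show ?thesis by simp
qed

section \<open>Trees grown from a root by attaching leaves\<close>

text \<open>Rule induction peels off the leaf \<open>v\<close> attached last. Since \<open>v\<close>
  is not in \<open>S\<close>, no edge of the smaller tree contains \<open>v\<close>.\<close>

inductive grown_tree :: "'v set set \<Rightarrow> 'v \<Rightarrow> 'v set \<Rightarrow> 'v set set \<Rightarrow> bool" for E r where
  root: "grown_tree E r {r} {}"
| leaf: "grown_tree E r S T \<Longrightarrow> p \<in> S \<Longrightarrow> v \<notin> S \<Longrightarrow> {p, v} \<in> E
    \<Longrightarrow> grown_tree E r (insert v S) (insert {p, v} T)"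

lemma grown_tree_edges: "grown_tree E r S T \<Longrightarrow> e \<in> T \<Longrightarrow> e \<in> E \<and> e \<subseteq> S"
  by (induction rule: grown_tree.induct) auto

lemma grown_tree_root: "grown_tree E r S T \<Longrightarrow> r \<in> S"
  by (induction rule: grown_tree.induct) auto

text \<open>A maximal vertex set carrying a grown tree is closed under adjacency, so connectedness
  makes it all of \<open>V\<close>.\<close>

lemma ex_spanning_grown_tree:
  assumes "graph_connected V E" and "finite V" and "r \<in> V" and "\<And>e. e \<in> E \<Longrightarrow> e \<subseteq> V"
  shows "\<exists>T. grown_tree E r V T"
proof -
  define \<S> where "\<S> = {S. S \<subseteq> V \<and> (\<exists>T. grown_tree E r S T)}"
  have "finite \<S>"
    using assms(2) by (auto simp: \<S>_def)
  moreover have "{r} \<in> \<S>"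
    using assms(3) grown_tree.root[of E r] by (auto simp: \<S>_def)
  ultimately obtain S where S: "S \<in> \<S>" and max: "\<And>S'. S' \<in> \<S> \<Longrightarrow> S \<subseteq> S' \<Longrightarrow> S' = S"
    using finite_has_maximal2 by metis
  obtain T where T: "grown_tree E r S T" using S by (auto simp: \<S>_def)
  have closed: "v \<in> S" if "p \<in> S" "{p, v} \<in> E" for p v
  proof (rule ccontr)
    assume "v \<notin> S"
    then have "grown_tree E r (insert v S) (insert {p, v} T)"
      using T that grown_tree.leaf by metis
    moreover have "insert v S \<subseteq> V"
      using S assms(4)[OF that(2)] by (auto simp: \<S>_def)
    ultimately have "insert v S \<in> \<S>" by (auto simp: \<S>_def)
    with max \<open>v \<notin> S\<close> show False by blast
  qed
  have "v \<in> S" if "v \<in> V" for v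
  proof -
    have "(r, v) \<in> {(a, b). {a, b} \<in> E}\<^sup>*"
      using assms(1,3) that by (auto simp: graph_connected_def)
    then show ?thesis
      by (induction rule: rtrancl_induct) (use closed grown_tree_root[OF T] in auto)
  qed
  then have "S = V" using S by (auto simp: \<S>_def)
  with T show ?thesis by blast
qed

section \<open>Existence, continuity and comparison of vectors with prescribed loads\<close>

locale increasing_loads =
  fixes V W :: "'v set" and E :: "'v set set" and f :: "'v \<Rightarrow> ('v set \<Rightarrow> real) \<Rightarrow> real"
  assumes finite_E: "finite E"
    and bipartition: "{p, v} \<in> E \<Longrightarrow> p \<in> W \<longleftrightarrow> v \<notin> W"
    and increasing: "v \<in> V \<Longrightarrow> f v \<in> increasing_bij_maps (incident_edges E v)"
begin

definition load :: "'v \<Rightarrow> ('v set \<Rightarrow> real) \<Rightarrow> real" where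
  "load v x = f v (restrict x (incident_edges E v))"

lemma load_cong: "(\<And>e. e \<in> E \<Longrightarrow> v \<in> e \<Longrightarrow> x e = y e) \<Longrightarrow> load v x = load v y"
  unfolding load_def by (rule arg_cong[where f = "f v"]) (auto simp: restrict_def incident_edges_def)

lemma load_upd_less_iff:
  assumes "v \<in> V" "e \<in> E" "v \<in> e"
  shows "load v (x(e := s)) < load v (x(e := t)) \<longleftrightarrow> s < t"
  unfolding load_def
  using strict_mono_less[OF increasing_bij_maps_restrict_upd(1)[OF increasing[OF assms(1)], of e x]] assms
  by (simp add: incident_edges_def)

lemma load_upd_le_iff:
  assumes "v \<in> V" "e \<in> E" "v \<in> e"
  shows "load v (x(e := s)) \<le> load v (x(e := t)) \<longleftrightarrow> s \<le> t"
  using load_upd_less_iff[OF assms, of x t s] by linarith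

lemma ex_load_upd:
  assumes "v \<in> V" "e \<in> E" "v \<in> e"
  shows "\<exists>t. load v (x(e := t)) = c"
proof -
  have "bij (\<lambda>t. load v (x(e := t)))"
    unfolding load_def using increasing_bij_maps_restrict_upd(2)[OF increasing[OF assms(1)]] assms
    by (simp add: incident_edges_def)
  then show ?thesis by (metis bij_pointE)
qed

lemma isCont_load:
  assumes "v \<in> V" and "\<And>e. e \<in> E \<Longrightarrow> isCont (\<lambda>s. B s e) a"
  shows "isCont (\<lambda>s::real. load v (B s)) a"
  unfolding load_def isCont_def
  by (rule tendsto_increasing_bij_maps[OF increasing[OF assms(1)]])
    (use finite_E assms(2) in \<open>auto simp: incident_edges_def isCont_def\<close>)

text \<open>The edge of the last leaf is fixed by the equation at that leaf; the result serves as
  the base vector for the smaller tree, hence the generalisation over \<open>B\<close>. The root is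
  left without an equation.\<close>

lemma tree_solution:
  assumes "grown_tree E r S T" and "S \<subseteq> V"
    and "\<And>v a. isCont (\<tau> v) a"
    and "\<And>e a. isCont (\<lambda>s::real. B s e) a"
  shows "\<exists>X. (\<forall>s. \<forall>e. e \<notin> T \<longrightarrow> X s e = B s e) \<and> (\<forall>e a. isCont (\<lambda>s. X s e) a)
    \<and> (\<forall>s. \<forall>v\<in>S - {r}. load v (X s) = \<tau> v s)"
  using assms(1,2,4)
proof (induction arbitrary: B rule: grown_tree.induct)
  case root
  then show ?case by (intro exI[of _ B]) auto
next
  case (leaf S T p v)
  let ?e = "{p, v}"
  have v: "v \<in> V" "?e \<in> E" "v \<in> ?e" using leaf by auto
  define g where "g s = (SOME t. load v ((B s)(?e := t)) = \<tau> v s)" for s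
  have g: "load v ((B s)(?e := g s)) = \<tau> v s" for s
    unfolding g_def by (rule someI_ex[OF ex_load_upd[OF v]])
  have cont_upd: "isCont (\<lambda>s. load v ((B s)(?e := t))) a" for t a
  proof (rule isCont_load[OF v(1)])
    show "isCont (\<lambda>s. ((B s)(?e := t)) e) a" for e
      using leaf.prems(2) by (cases "e = ?e") auto
  qed
  \<comment> \<open>By monotonicity, \<open>t < g s\<close> says that the load at \<open>v\<close>
    with \<open>t\<close> on \<open>?e\<close> is below \<open>\<tau> v s\<close>. Here
    \<open>t\<close> is fixed, so both sides are continuous in \<open>s\<close> and the strict
    inequality persists near \<open>a\<close>.\<close>
  have "isCont g a" for a
    unfolding isCont_def
  proof (rule order_tendstoI)
    fix t assume "t < g a"
    then have "load v ((B a)(?e := t)) - \<tau> v a < 0"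
      using load_upd_less_iff[OF v] g by (metis diff_less_0_iff_less)
    moreover have "isCont (\<lambda>s. load v ((B s)(?e := t)) - \<tau> v s) a"
      using cont_upd assms(3) by (intro continuous_diff)
    ultimately have "\<forall>\<^sub>F s in at a. load v ((B s)(?e := t)) - \<tau> v s < 0"
      unfolding isCont_def using order_tendstoD(2) by blast
    then show "\<forall>\<^sub>F s in at a. t < g s"
      by eventually_elim (metis diff_less_0_iff_less g load_upd_less_iff[OF v])
  next
    fix t assume "g a < t"
    then have "load v ((B a)(?e := t)) - \<tau> v a > 0"
      using load_upd_less_iff[OF v] g by (metis diff_gt_0_iff_gt)
    moreover have "isCont (\<lambda>s. load v ((B s)(?e := t)) - \<tau> v s) a"
      using cont_upd assms(3) by (intro continuous_diff)
    ultimately have "\<forall>\<^sub>F s in at a. load v ((B s)(?e := t)) - \<tau> v s > 0"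
      unfolding isCont_def using order_tendstoD(1) by blast
    then show "\<forall>\<^sub>F s in at a. g s < t"
      by eventually_elim (metis diff_gt_0_iff_gt g load_upd_less_iff[OF v])
  qed
  then have "isCont (\<lambda>s. ((B s)(?e := g s)) e) a" for e a
    using leaf.prems by (cases "e = ?e") auto
  moreover have "S \<subseteq> V" using leaf.prems(1) by simp
  ultimately have "\<exists>X. (\<forall>s. \<forall>e. e \<notin> T \<longrightarrow> X s e = ((B s)(?e := g s)) e)
    \<and> (\<forall>e a. isCont (\<lambda>s. X s e) a) \<and> (\<forall>s. \<forall>v\<in>S - {r}. load v (X s) = \<tau> v s)"
    by (intro leaf.IH)
  then obtain X where X: "\<forall>s. \<forall>e. e \<notin> T \<longrightarrow> X s e = ((B s)(?e := g s)) e"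
    "\<forall>e a. isCont (\<lambda>s. X s e) a" "\<forall>s. \<forall>v\<in>S - {r}. load v (X s) = \<tau> v s"
    by (elim exE conjE)
  \<comment> \<open>Solving on \<open>T\<close> leaves every edge at \<open>v\<close>
    untouched.\<close>
  have "load v (X s) = load v ((B s)(?e := g s))" for s
    by (rule load_cong, rule X(1)[rule_format]) (use grown_tree_edges[OF leaf.hyps(1)] leaf.hyps(3) in blast)
  then have "load w (X s) = \<tau> w s" if "w \<in> insert v S - {r}" for s w
    using that g X(3) by (cases "w = v") auto
  then show ?case
    using X(1,2) by (intro exI[of _ X]) auto
qed

text \<open>At the last leaf \<open>v\<close> the two vectors can differ only on
  \<open>{p, v}\<close>, so the inequality at \<open>v\<close> orders the two values there.
  Replacing that value of \<open>x\<close> by that of \<open>y\<close> moves the load at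
  \<open>p\<close> in the direction that preserves the inequality at \<open>p\<close>, because
  \<open>p\<close> and \<open>v\<close> lie on opposite sides. Induction then applies to the smaller
  tree.\<close>

lemma tree_comparison:
  assumes "grown_tree E r S T" and "S \<subseteq> V"
    and "\<And>e. e \<notin> T \<Longrightarrow> x e = y e"
    and "\<And>v. v \<in> S \<Longrightarrow> v \<in> W \<Longrightarrow> load v x \<le> load v y"
    and "\<And>v. v \<in> S \<Longrightarrow> v \<notin> W \<Longrightarrow> load v y \<le> load v x"
  shows "x = y"
  using assms
proof (induction arbitrary: x rule: grown_tree.induct)
  case root
  then show ?case by auto
next
  case (leaf S T p v)
  let ?e = "{p, v}"
  let ?x = "x(?e := y ?e)"
  have v: "v \<in> V" "?e \<in> E" "v \<in> ?e" and p: "p \<in> V" "?e \<in> E" "p \<in> ?e"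
    using leaf by auto
  have ypv: "load v y = load v ?x"
  proof (rule load_cong)
    fix e assume "v \<in> e"
    then have "e \<notin> T" using grown_tree_edges[OF leaf.hyps(1)] leaf.hyps(3) by blast
    then show "y e = ?x e" using leaf.prems(2)[of e] by simp
  qed
  have others: "load w ?x = load w x" if "w \<in> S" "w \<noteq> p" for w
    by (rule load_cong) (use that leaf.hyps(3) in auto)
  have off: "?x e = y e" if "e \<notin> T" for e
    using leaf.prems(2)[of e] that by auto
  show ?case
  proof (cases "v \<in> W")
    case True
    then have pW: "p \<notin> W" using bipartition[OF v(2)] by blast
    have "load v x \<le> load v ?x" using leaf.prems(3)[of v] True ypv by simp
    then have le: "x ?e \<le> y ?e" using load_upd_le_iff[OF v, of x "x ?e" "y ?e"] by simp
    then have "load p x \<le> load p ?x" using load_upd_le_iff[OF p, of x "x ?e" "y ?e"] by simp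
    moreover have yp: "load p y \<le> load p x" using leaf.prems(4)[of p] leaf.hyps(2) pW by simp
    ultimately have le_p: "load p y \<le> load p ?x" by linarith
    have "?x = y"
    proof (rule leaf.IH)
      show "S \<subseteq> V" using leaf.prems(1) by blast
      show "?x e = y e" if "e \<notin> T" for e using off[OF that] .
      show "load w ?x \<le> load w y" if "w \<in> S" "w \<in> W" for w
        using leaf.prems(3)[of w] others[of w] that le_p pW by (cases "w = p") (blast, simp)
      show "load w y \<le> load w ?x" if "w \<in> S" "w \<notin> W" for w
        using leaf.prems(4)[of w] others[of w] that le_p pW by (cases "w = p") (blast, simp)
    qed
    \<comment> \<open>Now \<open>x\<close> and \<open>y\<close> agree off \<open>?e\<close>, so the
      original inequality at \<open>p\<close> yields the reverse order on \<open>?e\<close>.\<close>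
    then have "y ?e \<le> x ?e"
      using yp load_upd_le_iff[OF p, of x "y ?e" "x ?e"] by simp
    with le \<open>?x = y\<close> show ?thesis by (metis antisym fun_upd_triv)
  next
    case False
    then have pW: "p \<in> W" using bipartition[OF v(2)] by blast
    have "load v ?x \<le> load v x" using leaf.prems(4)[of v] False ypv by simp
    then have le: "y ?e \<le> x ?e" using load_upd_le_iff[OF v, of x "y ?e" "x ?e"] by simp
    then have "load p ?x \<le> load p x" using load_upd_le_iff[OF p, of x "y ?e" "x ?e"] by simp
    moreover have yp: "load p x \<le> load p y" using leaf.prems(3)[of p] leaf.hyps(2) pW by simp
    ultimately have le_p: "load p ?x \<le> load p y" by linarith
    have "?x = y"
    proof (rule leaf.IH)
      show "S \<subseteq> V" using leaf.prems(1) by blast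
      show "?x e = y e" if "e \<notin> T" for e using off[OF that] .
      show "load w ?x \<le> load w y" if "w \<in> S" "w \<in> W" for w
        using leaf.prems(3)[of w] others[of w] that le_p pW by (cases "w = p") (blast, simp)
      show "load w y \<le> load w ?x" if "w \<in> S" "w \<notin> W" for w
        using leaf.prems(4)[of w] others[of w] that le_p pW by (cases "w = p") (blast, simp)
    qed
    then have "x ?e \<le> y ?e"
      using yp load_upd_le_iff[OF p, of x "x ?e" "y ?e"] by simp
    with le \<open>?x = y\<close> show ?thesis by (metis antisym fun_upd_triv)
  qed
qed

end

section \<open>Equalising the loads on \<open>W\<close>\<close>

theorem theorem1p3:
  fixes U W :: "'v set" and E :: "'v set set"
    and d :: "'v \<Rightarrow> real" and f :: "'v \<Rightarrow> ('v set \<Rightarrow> real) \<Rightarrow> real"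
  assumes "bipartite_graph U W E"
    and "finite U" and "finite W" and "W \<noteq> {}"
    and "\<forall>v \<in> U \<union> W. f v \<in> increasing_bij_maps (incident_edges E v)"
    and "graph_connected (U \<union> W) E"
  shows "\<forall>x \<in> feasible_set U E d f. load_max W E f x > load_min W E f x \<longrightarrow>
    (\<exists>x' \<in> feasible_set U E d f.
      load_max W E f x > load_max W E f x' \<and>
      load_max W E f x' = load_min W E f x' \<and>
      load_min W E f x' > load_min W E f x)"
proof (intro ballI impI)
  fix x
  assume x: "x \<in> feasible_set U E d f" and lt: "load_max W E f x > load_min W E f x"
  have disj: "U \<inter> W = {}" and ends: "\<And>e. e \<in> E \<Longrightarrow> \<exists>u\<in>U. \<exists>w\<in>W. e = {u, w}"
    using assms(1) by (auto simp: bipartite_graph_def)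
  have sub: "e \<subseteq> U \<union> W" if "e \<in> E" for e
    using ends[OF that] by auto
  interpret increasing_loads "U \<union> W" W E f
  proof
    have "E \<subseteq> Pow (U \<union> W)" using sub by blast
    then show "finite E" using assms(2,3) finite_subset by blast
    show "p \<in> W \<longleftrightarrow> v \<notin> W" if "{p, v} \<in> E" for p v
      using ends[OF that] disj by (auto simp: doubleton_eq_iff)
  qed (use assms(5) in blast)
  have loads: "load_max W E f y = Max ((\<lambda>w. load w y) ` W)"
    "load_min W E f y = Min ((\<lambda>w. load w y) ` W)" for y
    by (simp_all add: load_max_def load_min_def load_def)
  let ?M = "load_max W E f x" and ?m = "load_min W E f x"
  have bounds: "?m \<le> load w x" "load w x \<le> ?M" if "w \<in> W" for w
    using that assms(3) by (auto simp: loads)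
  obtain w1 w2 where w1: "w1 \<in> W" "load w1 x = ?m" and w2: "w2 \<in> W" "load w2 x = ?M"
    using Min_in[of "(\<lambda>w. load w x) ` W"] Max_in[of "(\<lambda>w. load w x) ` W"] assms(3,4)
    unfolding loads by fastforce
  obtain r where r: "r \<in> W" using assms(4) by blast
  obtain T where T: "grown_tree E r (U \<union> W) T"
    using ex_spanning_grown_tree[OF assms(6)] assms(2,3) r sub by blast
  \<comment> \<open>The targets are the constraint values on \<open>U\<close> and one common level
    \<open>s\<close> on \<open>W\<close>.\<close>
  define \<tau> where "\<tau> v s = (if v \<in> W then s else d v)" for v and s :: real
  have "isCont (\<tau> v) a" for v a
    by (cases "v \<in> W") (simp_all add: \<tau>_def[abs_def])
  then obtain X where off: "\<And>s e. e \<notin> T \<Longrightarrow> X s e = x e"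
    and cont: "\<And>e a. isCont (\<lambda>s. X s e) a"
    and sol: "\<And>s v. v \<in> U \<union> W - {r} \<Longrightarrow> load v (X s) = \<tau> v s"
    using tree_solution[OF T subset_refl, of \<tau> "\<lambda>s. x", OF _ continuous_const] by blast
  have solU: "load u (X s) = d u" if "u \<in> U" for u s
  proof -
    have "u \<notin> W" using that disj by blast
    then show ?thesis using sol[of u s] that r by (auto simp: \<tau>_def)
  qed
  have solW: "load w (X s) = s" if "w \<in> W" "w \<noteq> r" for w s
    using sol[of w] that by (auto simp: \<tau>_def)
  have xU: "load u x = d u" if "u \<in> U" for u
    using x that by (simp add: feasible_set_def load_def)
  have upper: "load r (X s) < s" if "?M \<le> s" for s
  proof (rule ccontr)
    assume "\<not> load r (X s) < s"
    then have ge: "s \<le> load w (X s)" if "w \<in> W" for w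
      using solW[OF that] by (cases "w = r") auto
    have "x = X s"
    proof (rule tree_comparison[OF T subset_refl])
      show "load v x \<le> load v (X s)" if "v \<in> W" for v
        using bounds(2)[OF that] ge[OF that] \<open>?M \<le> s\<close> by linarith
    qed (use off solU xU in auto)
    \<comment> \<open>Equality would give \<open>s \<le> ?m\<close> at the minimising vertex
      \<open>w1\<close>, against \<open>?m < ?M \<le> s\<close>.\<close>
    then show False using ge[OF w1(1)] w1(2) lt that by simp
  qed
  have lower: "s < load r (X s)" if "s \<le> ?m" for s
  proof (rule ccontr)
    assume "\<not> s < load r (X s)"
    then have le: "load w (X s) \<le> s" if "w \<in> W" for w
      using solW[OF that] by (cases "w = r") auto
    have "X s = x"
    proof (rule tree_comparison[OF T subset_refl])
      show "load v (X s) \<le> load v x" if "v \<in> W" for v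
        using bounds(1)[OF that] le[OF that] \<open>s \<le> ?m\<close> by linarith
    qed (use off solU xU in auto)
    then show False using le[OF w2(1)] w2(2) lt that by simp
  qed
  have "isCont (\<lambda>s. load r (X s) - s) a" for a
    using r by (intro continuous_diff isCont_load cont continuous_ident) auto
  then obtain s where s: "?m \<le> s" "s \<le> ?M" "load r (X s) - s = 0"
    using IVT2[of "\<lambda>s. load r (X s) - s" ?M 0 ?m] upper[of ?M] lower[of ?m] lt by auto
  \<comment> \<open>At both endpoints the load at \<open>r\<close> differs strictly from
    \<open>s\<close>, so the zero is interior.\<close>
  then have strict: "?m < s" "s < ?M"
    using upper[of ?M] lower[of ?m] by (auto simp: less_le)
  have all: "(\<lambda>w. load w (X s)) ` W = {s}"
    using solW s(3) r by force
  \<comment> \<open>Membership in \<open>feasible_set\<close> requires the default value off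
    \<open>E\<close>; \<open>X s\<close> inherits it from \<open>x\<close> because tree edges lie in
    \<open>E\<close>.\<close>
  have "X s e = undefined" if "e \<notin> E" for e
    using off[of e s] grown_tree_edges[OF T, of e] x that
    by (auto simp: feasible_set_def PiE_def extensional_def)
  then have "X s \<in> feasible_set U E d f"
    using solU by (auto simp: feasible_set_def load_def PiE_def extensional_def)
  moreover have "load_max W E f (X s) = s" "load_min W E f (X s) = s"
    by (simp_all add: loads all)
  ultimately show "\<exists>x' \<in> feasible_set U E d f.
      load_max W E f x > load_max W E f x' \<and>
      load_max W E f x' = load_min W E f x' \<and>
      load_min W E f x' > load_min W E f x"
    using strict by (intro bexI[of _ "X s"]) auto
qed

end
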